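(* Let $L^{(\lambda)}$, $\lambda>0$, be the deltoid operator on the deltoid domain $D$. (1) For $0<\lambda<1$, $L^{(\lambda)}$ does not satisfy any $CD(\rho,\infty)$ inequality: there is no $\rho\in\mathbb{R}$ for which $CD(\rho,\infty)$ holds. (2) For $\lambda>1$, $L^{(\lambda)}$ satisfies no $CD(\rho,n)$ inequality ($\rho\in\mathbb{R}$) for any $n<2\lambda$. Moreover, the best (largest) constant $\rho$ for which $L^{(\lambda)}$ satisfies $CD(\rho,2\lambda)$ is $\rho=\frac{3(\lambda-1)}{4}$.
   Context: Deltoid domain: let $D\subset\mathbb{R}^2\simeq\mathbb{C}$ be the bounded open domain containing $0$ whose boundary is the deltoid curve $t\mapsto \frac13(2e^{it}+e^{-2it})$. Write $Z=x+iy$, $\bar Z=x-iy$ for the coordinates, $\partial_Z,\partial_{\bar Z}$ for the usual complex derivatives. For a real parameter $\lambda>0$, the deltoid operator is $$L^{(\lambda)}f=(\bar Z-Z^2)\,\partial_Z^2 f+(1-Z\bar Z)\,\partial_Z\partial_{\bar Z}f+(Z-\bar Z^2)\,\partial_{\bar Z}^2f-\lambda\,(Z\partial_Z f+\bar Z\partial_{\bar Z} f),$$ i.e. the diffusion operator with (complex-bilinear) $\Gamma(Z,Z)=\bar Z-Z^2$, $\Gamma(\bar Z,\bar Z)=Z-\bar Z^2$, $\Gamma(Z,\bar Z)=\frac12(1-Z\bar Z)$, $L^{(\lambda)}Z=-\lambda Z$, $L^{(\lambda)}\bar Z=-\lambda\bar Z$. It is elliptic in $D$. Let $\mathcal{A}$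 be the set of restrictions to $D$ of real functions that are smooth in a neighborhood of $\overline D$. For the deltoid operator $L=L^{(\lambda)}$, set $\Gamma(f,g)=\frac12\big(L(fg)-fLg-gLf\big)$ and $\Gamma_2(f,f)=\frac12 L\Gamma(f,f)-\Gamma(f,Lf)$. For $\rho\in\mathbb{R}$, $n\in[1,\infty]$, $L$ satisfies $CD(\rho,n)$ if $\Gamma_2(f,f)\ge\rho\,\Gamma(f,f)+\frac1n(Lf)^2$ on $D$ for all $f\in\mathcal{A}$ (with $\frac1n=0$ if $n=\infty$). *)

theory Defs
  imports "HOL-Analysis.Analysis"
begin

section \<open>The deltoid domain\<close>

definition deltoid_curve :: "complex set" where
  "deltoid_curve = range (\<lambda>t::real. (2 * cis t + cis (- 2 * t)) / 3)"

definition deltoid_domain :: "complex set" where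
  "deltoid_domain =
     (THE D. open D \<and> connected D \<and> bounded D \<and> 0 \<in> D \<and> frontier D = deltoid_curve)"

text \<open>
  The description above determines exactly one set, namely the positivity set of the determinant
  of the principal symbol of the deltoid operator.
\<close>

definition deltoid_poly :: "complex \<Rightarrow> real" where
  "deltoid_poly z = ((1 - (cmod z)\<^sup>2) / 2)\<^sup>2 - (cmod (cnj z - z\<^sup>2))\<^sup>2"

lemma deltoid_poly_alt:
  "deltoid_poly z = 1/4 - 3/2 * (cmod z)^2 - 3/4 * (cmod z)^4 + 2 * Re (z^3)"
proof -
  have "(cmod z)^4 = ((cmod z)^2)^2" by simp
  then show ?thesis
    unfolding deltoid_poly_def cmod_power2
    by (simp add: power2_eq_square power3_eq_cube field_simps)
qed

lemma deltoid_poly_scale: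
  assumes "z \<noteq> 0" "deltoid_poly z \<ge> 0" "0 \<le> t" "t < 1"
  shows "deltoid_poly (of_real t * z) > deltoid_poly z"
proof -
  define r where "r = cmod z"
  define c where "c = Re (z^3)"
  have r: "r > 0" using assms by (simp add: r_def)
  have c: "c \<le> r^3"
    unfolding c_def r_def by (metis complex_Re_le_cmod norm_power)
  let ?p = "\<lambda>s. 1/4 - 3/2 * s^2 * r^2 - 3/4 * s^4 * r^4 + 2 * s^3 * c"
  have P: "deltoid_poly (of_real s * z) = ?p s" for s
    by (simp add: deltoid_poly_alt norm_mult power_mult_distrib c_def r_def flip: of_real_power)
  have "?p t - ?p 1 = 3/2 * r^2 * (1-t^2) + 3/4 * r^4 * (1 - t^4) - 2 * c * (1 - t^3)"
    by (simp add: field_simps)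
  moreover have "c * (1 - t^3) \<le> r^3 * (1 - t^3)"
    using c assms by (intro mult_right_mono) (auto simp: power_le_one)
  moreover have "3/2 * r^2 * (1-t^2) + 3/4 * r^4 * (1 - t^4) - 2 * r^3 * (1 - t^3) > 0"
  proof -
    have "3/2 * r^2 * (1-t^2) + 3/4 * r^4 * (1 - t^4) - 2 * r^3 * (1 - t^3)
       = r^2 * (1-t) * (3/2 * (1+t) + 3/4 * r^2 * (1+t) * (1+t^2) - 2 * r * (1+t+t^2))"
      by (simp add: algebra_simps power2_eq_square power3_eq_cube power4_eq_xxxx)
    moreover have "3/2 * (1+t) + 3/4 * r^2 * (1+t) * (1+t^2) - 2 * r * (1+t+t^2) > 0"
    proof -
      define A where "A = (1+t)*(1+t^2)"
      define B where "B = 1+t+t^2"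
      have A: "A > 0" using assms by (auto simp: A_def intro!: mult_pos_pos add_pos_nonneg)
      have eq: "9 * (1+t) * A - 8 * B^2 = (1-t)^2 * (t^2 + 4*t + 1)"
        unfolding A_def B_def
        by (simp add: algebra_simps power2_eq_square power3_eq_cube power4_eq_xxxx)
      have "(1-t)^2 * (t^2 + 4*t + 1) > 0"
        using assms by (intro mult_pos_pos) (auto intro!: add_nonneg_pos add_nonneg_nonneg)
      then have pos: "2 * (9 * (1+t) * A - 8 * B^2) > 0" unfolding eq by simp
      have eq2: "12 * A * (3/2 * (1+t) + 3/4 * r^2 * A - 2 * r * B)
          = (3 * r * A - 4 * B)^2 + 2 * (9 * (1+t) * A - 8 * B^2)"
        by (simp add: algebra_simps power2_eq_square)
      have "12 * A * (3/2 * (1+t) + 3/4 * r^2 * A - 2 * r * B) > 0"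
        unfolding eq2 by (rule add_nonneg_pos[OF zero_le_power2 pos])
      then have "3/2 * (1+t) + 3/4 * r^2 * A - 2 * r * B > 0"
        using A by (simp add: zero_less_mult_iff)
      then show ?thesis by (simp add: A_def B_def mult.assoc)
    qed
    ultimately show ?thesis using r assms by (simp only:) (intro mult_pos_pos, auto)
  qed
  ultimately have "?p t > ?p 1" by linarith
  then show ?thesis using P[of t] P[of 1] by simp
qed

lemma deltoid_poly_curve: "deltoid_poly z = 0 \<longleftrightarrow> z \<in> deltoid_curve"
proof
  assume "z \<in> deltoid_curve"
  then obtain t where z: "z = (2 * cis t + cis (- 2 * t)) / 3"
    by (auto simp: deltoid_curve_def)
  define c s where "c = cos t" and "s = sin t"
  have cs: "s^2 = 1 - c^2" by (simp add: c_def s_def sin_squared_eq)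
  have re: "Re z = (2 * c + (c^2 - s^2)) / 3" and im: "Im z = (2 * s - 2 * s * c) / 3"
    by (simp_all add: z c_def s_def cos_double sin_double)
  have re': "Re z = (2 * c + 2 * c^2 - 1) / 3" using re cs by simp
  have im2: "(Im z)^2 = (1 - c^2) * (2 - 2*c)^2 / 9"
    unfolding cs[symmetric] im by (simp add: power2_eq_square algebra_simps)
  have n2: "(cmod z)^2 = (5 + 4 * (4 * c^3 - 3 * c)) / 9"
    unfolding cmod_power2 im2 unfolding re'
    by (simp add: power2_eq_square power3_eq_cube field_simps)
  have "Re (z^3) = Re z * ((Re z)^2 - 3 * (Im z)^2)"
    by (simp add: power2_eq_square power3_eq_cube algebra_simps)
  then have r3: "Re (z^3) = (2 * c + 2 * c^2 - 1) / 3 *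
      (((2 * c + 2 * c^2 - 1) / 3)^2 - (1 - c^2) * (2 - 2*c)^2 / 3)"
    by (simp add: re' im2)
  have "(cmod z)^4 = ((cmod z)^2)^2" by simp
  then show "deltoid_poly z = 0"
    unfolding deltoid_poly_alt n2 r3
    by (simp add: power2_eq_square power3_eq_cube field_simps)
next
  assume P: "deltoid_poly z = 0"
  have "\<exists>u. cmod u = 1 \<and> 2 * u + (cnj u)^2 = 3 * z"
  proof (cases "cnj z = z^2")
    case True
    then have n: "cmod z = 1"
      using P by (simp add: deltoid_poly_def power2_eq_1_iff)
        (metis norm_ge_zero neg_0_le_iff_le not_one_le_zero)
    have "(cnj z)^2 = cnj (cnj z)" by (subst True) simp
    then show ?thesis using n by (intro exI[of _ z]) simp
  next
    case False
    define a b s where "a = cnj z - z^2" and "b = z - (cnj z)^2" and "s = 1 - z * cnj z"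
    have ba: "b = cnj a" and ss: "cnj s = s" by (simp_all add: a_def b_def s_def mult.commute)
    have a0: "a \<noteq> 0" using False by (simp add: a_def)
    then have b0: "b \<noteq> 0" by (simp add: ba)
    have s: "s = of_real (1 - (cmod z)^2)"
      using complex_norm_square[of z] by (simp add: s_def)
    have "of_real (deltoid_poly z) = s^2 / 4 - a * b"
      unfolding deltoid_poly_def s ba complex_norm_square[symmetric] a_def
      by (simp add: power_divide)
    then have ab: "s^2 = 4 * a * b" using P by simp
    define u where "u = s / (2 * a)"
    have cu: "cnj u = s / (2 * b)" by (simp add: u_def ba ss)
    have "u * cnj u = s / (2 * a) * (s / (2 * b))" unfolding cu by (simp add: u_def)
    also have "\<dots> = 1" using ab a0 b0 by (simp add: field_simps power2_eq_square)
    finally have "cmod u = 1"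
      using complex_norm_square[of u] by (simp add: power2_eq_1_iff flip: of_real_power)
        (metis norm_ge_zero neg_0_le_iff_le not_one_le_zero)
    moreover have "2 * u + (cnj u)^2 = 3 * z"
    proof -
      have "a^2 + s * b - 3 * z * a * b = z * (s^2 - 4 * a * b)"
        unfolding a_def b_def s_def
        by (simp add: algebra_simps power2_eq_square)
      then have *: "a^2 + s * b = 3 * z * a * b" using ab by simp
      have "2 * u + (cnj u)^2 = s / a + s^2 / (4 * b^2)"
        unfolding cu by (simp add: u_def power_divide power_mult_distrib)
      also have "\<dots> = (a^2 + s * b) / (a * b)"
        unfolding ab using a0 b0 by (simp add: field_simps power2_eq_square)
      finally show ?thesis unfolding * using a0 b0 by simp
    qed
    ultimately show ?thesis by blast
  qed
  then obtain u where u: "cmod u = 1" "2 * u + (cnj u)^2 = 3 * z" by blast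
  have "u = cis (Arg u)" using u(1)
    by (metis cis_Arg norm_zero sgn_eq div_by_1 of_real_1 zero_neq_one)
  then have "2 * cis (Arg u) + cis (- 2 * Arg u) = 3 * z"
    using u(2) by (metis cis_cnj Complex.DeMoivre of_nat_numeral mult_minus_left mult_minus_right)
  then show "z \<in> deltoid_curve"
    unfolding deltoid_curve_def by (intro image_eqI[of _ _ "Arg u"]) auto
qed

lemma continuous_deltoid_poly: "continuous_on A deltoid_poly"
  unfolding deltoid_poly_def by (intro continuous_intros) auto

lemma deltoid_poly_set:
  "open {z. deltoid_poly z > 0} \<and> connected {z. deltoid_poly z > 0} \<and>
   bounded {z. deltoid_poly z > 0} \<and> 0 \<in> {z. deltoid_poly z > 0} \<and>
   frontier {z. deltoid_poly z > 0} = deltoid_curve"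
proof -
  let ?D = "{z. deltoid_poly z > 0}"
  have zero: "0 \<in> ?D" by (simp add: deltoid_poly_def power2_eq_square)
  have opn: "open ?D"
    by (rule open_Collect_less) (auto intro: continuous_deltoid_poly)
  have "starlike ?D"
    unfolding starlike_def
  proof (intro bexI[of _ 0] ballI subsetI)
    fix z w assume z: "z \<in> ?D" and "w \<in> closed_segment 0 z"
    then obtain t where t: "0 \<le> t" "t \<le> 1" "w = of_real t * z"
      by (auto simp: closed_segment_def scaleR_conv_of_real)
    show "w \<in> ?D"
      using z t zero deltoid_poly_scale[of z t] by (cases "z = 0"; cases "t = 1") auto
  qed (rule zero)
  then have con: "connected ?D" by (rule starlike_imp_connected)
  have "cmod z \<le> 1" if "z \<in> ?D" for z
  proof (rule ccontr)
    assume "\<not> cmod z \<le> 1"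
    then have n: "cmod z > 1" and z0: "z \<noteq> 0" by auto
    have "deltoid_poly (of_real (1 / cmod z) * z) > deltoid_poly z"
      using that n z0 by (intro deltoid_poly_scale) auto
    moreover have "cmod (of_real (1 / cmod z) * z) = 1" using z0 by (simp add: norm_mult norm_divide)
    moreover have "deltoid_poly w \<le> 0" if "cmod w = 1" for w
      using that by (simp add: deltoid_poly_def)
    ultimately show False using that by fastforce
  qed
  then have bdd: "bounded ?D" unfolding bounded_iff by blast
  have "frontier ?D = {z. deltoid_poly z = 0}"
  proof (intro equalityI subsetI)
    fix z assume "z \<in> frontier ?D"
    then have z: "z \<in> closure ?D" "z \<notin> ?D" using opn by (auto simp: frontier_def interior_open)
    have "closed {z. 0 \<le> deltoid_poly z}"
      by (rule closed_Collect_le) (auto intro: continuous_deltoid_poly)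
    then have "closure ?D \<subseteq> {z. 0 \<le> deltoid_poly z}" by (intro closure_minimal) auto
    then show "z \<in> {z. deltoid_poly z = 0}" using z by auto
  next
    fix z assume "z \<in> {z. deltoid_poly z = 0}"
    then have z: "deltoid_poly z = 0" by simp
    then have z0: "z \<noteq> 0" using zero by auto
    have "(\<lambda>n. of_real (1 - 1 / real (Suc n)) * z) \<longlonglongrightarrow> of_real (1 - 0) * z"
      by (intro tendsto_intros LIMSEQ_inverse_real_of_nat[unfolded inverse_eq_divide])
    moreover have "of_real (1 - 1 / real (Suc n)) * z \<in> ?D" for n
      using deltoid_poly_scale[of z "1 - 1 / real (Suc n)"] z z0 by auto
    ultimately have "z \<in> closure ?D"
      unfolding closure_sequential by (intro exI[of _ "\<lambda>n. of_real (1 - 1 / real (Suc n)) * z"]) auto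
    then show "z \<in> frontier ?D" using z opn by (auto simp: frontier_def interior_open)
  qed
  then have "frontier ?D = deltoid_curve" using deltoid_poly_curve by auto
  then show ?thesis using zero opn con bdd by blast
qed

lemma domain_frontier_unique:
  fixes D E :: "'a::topological_space set"
  assumes "open D" "connected D" "open E" "x \<in> D" "x \<in> E" "frontier D = frontier E"
  shows "D \<subseteq> E"
proof (rule ccontr)
  assume "\<not> D \<subseteq> E"
  then have "D \<inter> frontier E \<noteq> {}"
    using assms by (intro connected_Int_frontier) auto
  moreover have "D \<inter> frontier D = {}"
    using assms by (auto simp: frontier_def interior_open)
  ultimately show False using assms by simp
qed

lemma deltoid_domain_eq: "deltoid_domain = {z. deltoid_poly z > 0}"
  unfolding deltoid_domain_def
proof (rule the_equality)
  show "open {z. deltoid_poly z > 0} \<and> connected {z. deltoid_poly z > 0} \<and>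
    bounded {z. deltoid_poly z > 0} \<and> 0 \<in> {z. deltoid_poly z > 0} \<and>
    frontier {z. deltoid_poly z > 0} = deltoid_curve" by (rule deltoid_poly_set)
next
  fix D assume D: "open D \<and> connected D \<and> bounded D \<and> 0 \<in> D \<and> frontier D = deltoid_curve"
  show "D = {z. deltoid_poly z > 0}"
    using D deltoid_poly_set
      domain_frontier_unique[of D "{z. deltoid_poly z > 0}" 0]
      domain_frontier_unique[of "{z. deltoid_poly z > 0}" D 0] by blast
qed

lemma deltoid_domain_props:
  "open deltoid_domain" "connected deltoid_domain" "bounded deltoid_domain"
  "0 \<in> deltoid_domain" "frontier deltoid_domain = deltoid_curve"
  using deltoid_poly_set unfolding deltoid_domain_eq by blast+


section \<open>Smooth functions\<close>

text \<open>
  Real (Frechet) differentiability throughout, also for functions on the complex plane.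
  These notions are meant for open \<open>S\<close>.
\<close>

primrec higher_differentiable_on ::
  "nat \<Rightarrow> ('a::real_normed_vector \<Rightarrow> 'b::real_normed_vector) \<Rightarrow> 'a set \<Rightarrow> bool" where
  "higher_differentiable_on 0 f S \<longleftrightarrow> continuous_on S f"
| "higher_differentiable_on (Suc n) f S \<longleftrightarrow>
     (\<forall>x\<in>S. f differentiable (at x)) \<and>
     (\<forall>v. higher_differentiable_on n (\<lambda>x. frechet_derivative f (at x) v) S)"

definition smooth_on :: "('a::real_normed_vector \<Rightarrow> 'b::real_normed_vector) \<Rightarrow> 'a set \<Rightarrow> bool" where
  "smooth_on f S \<longleftrightarrow> (\<forall>n. higher_differentiable_on n f S)"

lemma has_real_derivative_along_line:
  fixes f :: "'a::real_normed_vector \<Rightarrow> real"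
  assumes "f differentiable (at (p + s *\<^sub>R u))"
  shows "((\<lambda>s. f (p + s *\<^sub>R u)) has_real_derivative frechet_derivative f (at (p + s *\<^sub>R u)) u) (at s)"
proof -
  let ?F = "frechet_derivative f (at (p + s *\<^sub>R u))"
  have F: "(f has_derivative ?F) (at (p + s *\<^sub>R u))"
    using assms frechet_derivative_works by blast
  have "((\<lambda>s. p + s *\<^sub>R u) has_derivative (\<lambda>x. x *\<^sub>R u)) (at s)"
    by (auto intro!: derivative_eq_intros)
  from has_derivative_compose[OF this F]
  have "((\<lambda>s. f (p + s *\<^sub>R u)) has_derivative (\<lambda>x. ?F (x *\<^sub>R u))) (at s)" .
  moreover have "?F (x *\<^sub>R u) = ?F u * x" for x
    using linear_scale[OF linear_frechet_derivative[OF assms]] by simp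
  ultimately show ?thesis by (simp add: has_field_derivative_def)
qed

lemma second_difference_mvt:
  fixes f :: "'a::real_normed_vector \<Rightarrow> real"
  assumes "norm u \<le> 1" "norm v \<le> 1" "h > 0" "cball z (2 * h) \<subseteq> U"
    and f: "\<And>x. x \<in> U \<Longrightarrow> f differentiable (at x)"
    and fu: "\<And>x. x \<in> U \<Longrightarrow> (\<lambda>x. frechet_derivative f (at x) u) differentiable (at x)"
  shows "\<exists>x\<in>cball z (2 * h). f (z + h *\<^sub>R u + h *\<^sub>R v) - f (z + h *\<^sub>R u) - f (z + h *\<^sub>R v) + f z
     = h\<^sup>2 * frechet_derivative (\<lambda>x. frechet_derivative f (at x) u) (at x) v"
proof -
  have inb: "z + s *\<^sub>R u + t *\<^sub>R v \<in> cball z (2 * h)" if "0 \<le> s" "s \<le> h" "0 \<le> t" "t \<le> h" for s t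
  proof -
    have "norm (s *\<^sub>R u + t *\<^sub>R v) \<le> s * norm u + t * norm v"
      using that by (intro order.trans[OF norm_triangle_ineq]) simp
    also have "\<dots> \<le> h * 1 + h * 1"
      using that assms by (intro add_mono mult_mono) auto
    finally show ?thesis by (simp add: dist_norm algebra_simps)
      (metis add.commute norm_minus_cancel minus_add_distrib uminus_add_conv_diff)
  qed
  let ?g = "\<lambda>x. frechet_derivative f (at x) u"
  define k where "k = (\<lambda>s. f ((z + h *\<^sub>R v) + s *\<^sub>R u) - f (z + s *\<^sub>R u))"
  have inU: "z + s *\<^sub>R u + t *\<^sub>R v \<in> U" if "0 \<le> s" "s \<le> h" "0 \<le> t" "t \<le> h" for s t
    using inb[OF that] assms by blast
  have "\<exists>s. 0 < s \<and> s < h \<and> k h - k 0 = (h - 0) * (?g ((z + h *\<^sub>R v) + s *\<^sub>R u) - ?g (z + s *\<^sub>R u))"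
  proof (rule MVT2)
    fix s assume s: "0 \<le> s" "s \<le> h"
    show "(k has_real_derivative (?g ((z + h *\<^sub>R v) + s *\<^sub>R u) - ?g (z + s *\<^sub>R u))) (at s)"
      unfolding k_def
      using inU[of s h] inU[of s 0] s assms(3)
      by (intro DERIV_diff has_real_derivative_along_line f) (auto simp: algebra_simps)
  qed (use assms in auto)
  then obtain s where s: "0 < s" "s < h"
    "k h - k 0 = h * (?g ((z + h *\<^sub>R v) + s *\<^sub>R u) - ?g (z + s *\<^sub>R u))" by auto
  define m where "m = (\<lambda>t. ?g ((z + s *\<^sub>R u) + t *\<^sub>R v))"
  have "\<exists>t. 0 < t \<and> t < h \<and> m h - m 0 = (h - 0) * frechet_derivative ?g (at ((z + s *\<^sub>R u) + t *\<^sub>R v)) v"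
  proof (rule MVT2)
    fix t assume t: "0 \<le> t" "t \<le> h"
    show "(m has_real_derivative frechet_derivative ?g (at ((z + s *\<^sub>R u) + t *\<^sub>R v)) v) (at t)"
      unfolding m_def using inU[of s t] s t by (intro has_real_derivative_along_line fu) auto
  qed (use assms in auto)
  then obtain t where t: "0 < t" "t < h"
    "m h - m 0 = h * frechet_derivative ?g (at ((z + s *\<^sub>R u) + t *\<^sub>R v)) v" by auto
  have "k h - k 0 = h * (m h - m 0)"
    using s(3) by (simp add: m_def add.assoc add.commute add.left_commute)
  then have "k h - k 0 = h\<^sup>2 * frechet_derivative ?g (at ((z + s *\<^sub>R u) + t *\<^sub>R v)) v"
    using t(3) by (simp add: power2_eq_square)
  moreover have "k h - k 0 = f (z + h *\<^sub>R u + h *\<^sub>R v) - f (z + h *\<^sub>R u) - f (z + h *\<^sub>R v) + f z"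
    by (simp add: k_def add.assoc add.commute add.left_commute)
  ultimately show ?thesis using inb[of s t] s t by (intro bexI[of _ "z + s *\<^sub>R u + t *\<^sub>R v"]) auto
qed

lemma mixed_derivatives_commute:
  fixes f :: "'a::real_normed_vector \<Rightarrow> real"
  assumes U: "open U" "z \<in> U" and f: "smooth_on f U" and uv: "norm u \<le> 1" "norm v \<le> 1"
  shows "frechet_derivative (\<lambda>x. frechet_derivative f (at x) u) (at z) v =
         frechet_derivative (\<lambda>x. frechet_derivative f (at x) v) (at z) u"
    (is "?A z = ?B z")
proof (rule ccontr)
  assume ne: "?A z \<noteq> ?B z"
  define e where "e = \<bar>?A z - ?B z\<bar> / 2"
  have e: "e > 0" using ne by (simp add: e_def)
  have "higher_differentiable_on (Suc (Suc 0)) f U" using f by (simp add: smooth_on_def)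
  then have d1: "\<And>x. x \<in> U \<Longrightarrow> f differentiable (at x)"
    and d2: "\<And>x w. x \<in> U \<Longrightarrow> (\<lambda>x. frechet_derivative f (at x) w) differentiable (at x)"
    and cA: "continuous_on U ?A" and cB: "continuous_on U ?B" by auto
  have "isCont ?A z" "isCont ?B z" using cA cB U continuous_on_eq_continuous_at by blast+
  then obtain a b where ab: "a > 0" "b > 0"
    "\<And>x. dist x z < a \<Longrightarrow> dist (?A x) (?A z) < e" "\<And>x. dist x z < b \<Longrightarrow> dist (?B x) (?B z) < e"
    using e unfolding continuous_at_eps_delta by metis
  obtain r where r: "r > 0" "cball z r \<subseteq> U" using U open_contains_cball by blast
  define h where "h = min r (min a b) / 4"
  have h: "h > 0" "2 * h < a" "2 * h < b" "cball z (2 * h) \<subseteq> U"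
    using ab r by (auto simp: h_def)
  obtain x where x: "x \<in> cball z (2 * h)"
    "f (z + h *\<^sub>R u + h *\<^sub>R v) - f (z + h *\<^sub>R u) - f (z + h *\<^sub>R v) + f z = h\<^sup>2 * ?A x"
    using second_difference_mvt[OF uv h(1,4) d1 d2] by blast
  obtain y where y: "y \<in> cball z (2 * h)"
    "f (z + h *\<^sub>R v + h *\<^sub>R u) - f (z + h *\<^sub>R v) - f (z + h *\<^sub>R u) + f z = h\<^sup>2 * ?B y"
    using second_difference_mvt[OF uv(2,1) h(1,4) d1 d2] by blast
  have "h\<^sup>2 * ?A x = h\<^sup>2 * ?B y" using x(2) y(2) by (simp add: algebra_simps)
  then have "?A x = ?B y" using h by simp
  moreover have "dist (?A x) (?A z) < e" "dist (?B y) (?B z) < e"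
    using x(1) y(1) h by (auto intro!: ab simp: dist_commute)
  ultimately have "\<bar>?A x - ?A z\<bar> < e" "\<bar>?A x - ?B z\<bar> < e" by (simp_all add: dist_real_def)
  then have "\<bar>?A z - ?B z\<bar> < 2 * e" by (smt (verit))
  then show False by (simp add: e_def)
qed

text \<open>
  Test functions are represented by total functions, of which only the values on a neighbourhood
  of the closed domain matter: the operators below are local and are evaluated only in the
  (open) domain.
\<close>

definition deltoid_test_functions :: "(complex \<Rightarrow> real) set" where
  "deltoid_test_functions = {f. \<exists>U. open U \<and> closure deltoid_domain \<subseteq> U \<and> smooth_on f U}"


section \<open>The deltoid operator\<close>

definition d_Z :: "(complex \<Rightarrow> complex) \<Rightarrow> complex \<Rightarrow> complex" where
  "d_Z f z = (frechet_derivative f (at z) 1 - \<i> * frechet_derivative f (at z) \<i>) / 2"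

definition d_Zbar :: "(complex \<Rightarrow> complex) \<Rightarrow> complex \<Rightarrow> complex" where
  "d_Zbar f z = (frechet_derivative f (at z) 1 + \<i> * frechet_derivative f (at z) \<i>) / 2"

definition deltoid_op_complex :: "real \<Rightarrow> (complex \<Rightarrow> complex) \<Rightarrow> complex \<Rightarrow> complex" where
  "deltoid_op_complex lam f z =
     (cnj z - z\<^sup>2) * d_Z (d_Z f) z + (1 - z * cnj z) * d_Z (d_Zbar f) z
     + (z - (cnj z)\<^sup>2) * d_Zbar (d_Zbar f) z
     - of_real lam * (z * d_Z f z + cnj z * d_Zbar f z)"

text \<open>
  On real functions the operator is real; \<open>Re\<close> only performs the coercion to the reals
  (see \<open>of_real_deltoid_op\<close> below).
\<close>

definition deltoid_op :: "real \<Rightarrow> (complex \<Rightarrow> real) \<Rightarrow> complex \<Rightarrow> real" where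
  "deltoid_op lam f z = Re (deltoid_op_complex lam (\<lambda>w. of_real (f w)) z)"


lemma frechet_derivative_of_real_comp:
  fixes f :: "complex \<Rightarrow> real"
  assumes "f differentiable (at z)"
  shows "frechet_derivative (\<lambda>w. complex_of_real (f w)) (at z) = (\<lambda>v. of_real (frechet_derivative f (at z) v))"
  by (rule frechet_derivative_at[symmetric], rule has_derivative_of_real)
    (rule assms[unfolded frechet_derivative_works])

lemma frechet_derivative_complex_combination:
  fixes f g :: "complex \<Rightarrow> real"
  assumes "open U" "z \<in> U" "f differentiable (at z)" "g differentiable (at z)"
    and h: "\<And>w. w \<in> U \<Longrightarrow> h w = (complex_of_real (f w) + c * of_real (g w)) / 2"
  shows "frechet_derivative h (at z) =
    (\<lambda>v. (of_real (frechet_derivative f (at z) v) + c * of_real (frechet_derivative g (at z) v)) / 2)"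
proof (rule frechet_derivative_at[symmetric])
  have f: "(f has_derivative frechet_derivative f (at z)) (at z)"
    and g: "(g has_derivative frechet_derivative g (at z)) (at z)"
    using assms frechet_derivative_works by blast+
  have *: "((\<lambda>w. (complex_of_real (f w) + c * of_real (g w)) * (1/2)) has_derivative
    (\<lambda>v. (of_real (frechet_derivative f (at z) v) + c * of_real (frechet_derivative g (at z) v)) * (1/2))) (at z)"
    by (intro has_derivative_mult_left has_derivative_add has_derivative_mult_right
        has_derivative_of_real f g)
  show "(h has_derivative (\<lambda>v. (of_real (frechet_derivative f (at z) v)
      + c * of_real (frechet_derivative g (at z) v)) / 2)) (at z)"
    by (rule has_derivative_transform_within_open[OF *[simplified] assms(1,2)]) (simp add: h)
qed

lemma of_real_deltoid_op:
  assumes U: "open U" "z \<in> U" and f: "smooth_on f U"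
  shows "complex_of_real (deltoid_op lam f z) = deltoid_op_complex lam (\<lambda>w. of_real (f w)) z"
proof -
  define F where "F = (\<lambda>w. complex_of_real (f w))"
  define fx fy where "fx = (\<lambda>w. frechet_derivative f (at w) 1)"
    and "fy = (\<lambda>w. frechet_derivative f (at w) \<i>)"
  have "higher_differentiable_on (Suc (Suc 0)) f U" using f by (simp add: smooth_on_def)
  then have d1: "\<And>x. x \<in> U \<Longrightarrow> f differentiable (at x)"
    and d2: "fx differentiable (at z)" "fy differentiable (at z)"
    using U unfolding fx_def fy_def by auto
  have dz: "d_Z F w = (of_real (fx w) + (- \<i>) * of_real (fy w)) / 2"
    and db: "d_Zbar F w = (of_real (fx w) + \<i> * of_real (fy w)) / 2" if "w \<in> U" for w
    unfolding d_Z_def d_Zbar_def F_def fx_def fy_def frechet_derivative_of_real_comp[OF d1[OF that]]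
    by simp_all
  have D: "frechet_derivative (d_Z F) (at z) v =
      (of_real (frechet_derivative fx (at z) v) + (- \<i>) * of_real (frechet_derivative fy (at z) v)) / 2"
    "frechet_derivative (d_Zbar F) (at z) v =
      (of_real (frechet_derivative fx (at z) v) + \<i> * of_real (frechet_derivative fy (at z) v)) / 2" for v
    by (rule fun_cong[OF frechet_derivative_complex_combination[OF U d2]], erule dz)
      (rule fun_cong[OF frechet_derivative_complex_combination[OF U d2]], erule db)
  have sym: "frechet_derivative fx (at z) \<i> = frechet_derivative fy (at z) 1"
    unfolding fx_def fy_def by (rule mixed_derivatives_commute[OF U f]) auto
  have "Im (deltoid_op_complex lam F z) = 0"
    unfolding deltoid_op_complex_def d_Z_def[of "d_Z F"] d_Z_def[of "d_Zbar F"]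
      d_Zbar_def[of "d_Zbar F"] D dz[OF U(2)] db[OF U(2)] sym
    by (simp add: field_simps power2_eq_square)
  then show ?thesis unfolding deltoid_op_def F_def by (simp add: complex_eq_iff)
qed


section \<open>Curvature-dimension inequalities\<close>

definition carre_du_champ ::
  "(('a \<Rightarrow> real) \<Rightarrow> 'a \<Rightarrow> real) \<Rightarrow> ('a \<Rightarrow> real) \<Rightarrow> ('a \<Rightarrow> real) \<Rightarrow> 'a \<Rightarrow> real" where
  "carre_du_champ L f g x = (L (\<lambda>y. f y * g y) x - f x * L g x - g x * L f x) / 2"

definition gamma2 :: "(('a \<Rightarrow> real) \<Rightarrow> 'a \<Rightarrow> real) \<Rightarrow> ('a \<Rightarrow> real) \<Rightarrow> 'a \<Rightarrow> real" where
  "gamma2 L f x = L (carre_du_champ L f f) x / 2 - carre_du_champ L f (L f) x"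

text \<open>The dimension \<open>n\<close> ranges over \<open>[1,\<infinity>]\<close>; for extended reals, \<open>1 / \<infinity> = 0\<close>.\<close>

definition deltoid_CD :: "real \<Rightarrow> real \<Rightarrow> ereal \<Rightarrow> bool" where
  "deltoid_CD lam \<rho> n \<longleftrightarrow>
     (\<forall>f\<in>deltoid_test_functions. \<forall>z\<in>deltoid_domain.
        gamma2 (deltoid_op lam) f z \<ge>
          \<rho> * carre_du_champ (deltoid_op lam) f f z + real_of_ereal (1 / n) * (deltoid_op lam f z)\<^sup>2)"

end

theory Submission
  imports Defs
begin

text \<open>
  In real coordinates the operator for \<open>lam = 1\<close> is the Laplacian of a flat metric whose inverse has
  entries \<open>co_xx, co_xy, co_yy\<close>, and the general operator is that Laplacian plus
  \<open>- (lam - 1) u\<close> with \<open>u = x f\<^sub>x + y f\<^sub>y\<close>. With \<open>W\<close> the mixed Hessian of \<open>f\<close> and \<open>adj\<close> the adjugate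
  of the inverse metric, Bochner's formula reads
  \<open>\<Gamma>\<^sub>2 = tr (W\<^sup>2) + (lam - 1) (u\<^sup>2 / 2 + 3/4 \<Gamma> + adj (df, df) / 4)\<close>, and the bound
  \<open>CD(3(lam - 1)/4, 2 lam)\<close> follows from \<open>tr (W\<^sup>2) \<ge> (tr W)\<^sup>2 / 2\<close> and the convexity of the square,
  applied to \<open>L f / lam = tr W / lam + (1 - 1 / lam) (- u)\<close>,
  the adjugate being positive inside the domain.
  The negative statements come from second-order jets on the real axis between the boundary
  point \<open>- 1/3\<close>, where \<open>\<Gamma>\<close> degenerates in the \<open>x\<close>-direction, and the cusp \<open>1\<close>, where it vanishes.
\<close>

section \<open>Calculus of smooth functions on open sets\<close>

text \<open>\<open>frechet_derivative\<close> is a choice among all derivatives at the point.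
  Functions that agree nearby have the same derivatives there, so the choices coincide even where no
  derivative exists.\<close>

lemma frechet_derivative_cong_open:
  assumes "open U" "x \<in> U" "\<And>y. y \<in> U \<Longrightarrow> f y = g y"
  shows "frechet_derivative f (at x) = frechet_derivative g (at x)"
proof -
  have "(f has_derivative F) (at x) \<longleftrightarrow> (g has_derivative F) (at x)" for F
    using assms has_derivative_transform_within_open[of f F x UNIV U g]
      has_derivative_transform_within_open[of g F x UNIV U f] by auto
  then show ?thesis by (simp add: frechet_derivative_def)
qed

lemma differentiable_cong_open:
  assumes "open U" "x \<in> U" "\<And>y. y \<in> U \<Longrightarrow> f y = g y" "f differentiable (at x)"
  shows "g differentiable (at x)"
  using assms has_derivative_transform_within_open[of f _ x UNIV U g]
  unfolding differentiable_def by auto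

lemma higher_differentiable_on_cong:
  assumes "open U" "\<And>x. x \<in> U \<Longrightarrow> f x = g x" "higher_differentiable_on n f U"
  shows "higher_differentiable_on n g U"
  using assms(2,3)
proof (induction n arbitrary: f g)
  case 0
  then show ?case by (simp cong: continuous_on_cong)
next
  case (Suc n)
  have "higher_differentiable_on n (\<lambda>x. frechet_derivative g (at x) v) U" for v
    by (rule Suc.IH[of "\<lambda>x. frechet_derivative f (at x) v"])
      (use Suc.prems frechet_derivative_cong_open[OF assms(1) _ Suc.prems(1)] in auto)
  then show ?case
    using Suc.prems differentiable_cong_open[OF assms(1) _ Suc.prems(1)] by auto
qed

text \<open>Needed for products: the product rule pairs a derivative of one factor with the other
  factor itself, which must then count as differentiable to the lower order.\<close>

lemma higher_differentiable_on_SucD: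
  assumes "higher_differentiable_on (Suc n) f U"
  shows "higher_differentiable_on n f U"
  using assms
proof (induction n arbitrary: f)
  case 0
  then show ?case
    by (auto intro!: differentiable_imp_continuous_on
        simp: differentiable_on_def differentiable_at_withinI)
qed auto

lemma frechet_derivative_add:
  assumes "f differentiable (at x)" "g differentiable (at x)"
  shows "frechet_derivative (\<lambda>x. f x + g x) (at x) v =
    frechet_derivative f (at x) v + frechet_derivative g (at x) v"
  using has_derivative_add[OF assms[unfolded frechet_derivative_works]]
  by (simp flip: frechet_derivative_at)

lemma higher_differentiable_on_add:
  assumes "open U" "higher_differentiable_on n f U" "higher_differentiable_on n g U"
  shows "higher_differentiable_on n (\<lambda>x. f x + g x) U"
  using assms(2,3)
proof (induction n arbitrary: f g)
  case 0
  then show ?case by (auto intro: continuous_intros)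
next
  case (Suc n)
  have "higher_differentiable_on n (\<lambda>x. frechet_derivative (\<lambda>x. f x + g x) (at x) v) U" for v
    by (rule higher_differentiable_on_cong[OF assms(1) _
          Suc.IH[of "\<lambda>x. frechet_derivative f (at x) v" "\<lambda>x. frechet_derivative g (at x) v"]])
      (use Suc.prems in \<open>auto simp: frechet_derivative_add\<close>)
  then show ?case using Suc.prems by auto
qed

lemma frechet_derivative_mult:
  fixes f g :: "'a::real_normed_vector \<Rightarrow> 'b::real_normed_algebra"
  assumes "f differentiable (at x)" "g differentiable (at x)"
  shows "frechet_derivative (\<lambda>x. f x * g x) (at x) v =
    f x * frechet_derivative g (at x) v + frechet_derivative f (at x) v * g x"
  using has_derivative_mult[OF assms[unfolded frechet_derivative_works]]
  by (simp flip: frechet_derivative_at)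

lemma higher_differentiable_on_mult:
  fixes f g :: "'a::real_normed_vector \<Rightarrow> 'b::real_normed_algebra"
  assumes "open U" "higher_differentiable_on n f U" "higher_differentiable_on n g U"
  shows "higher_differentiable_on n (\<lambda>x. f x * g x) U"
  using assms(2,3)
proof (induction n arbitrary: f g)
  case 0
  then show ?case by (auto intro: continuous_intros)
next
  case (Suc n)
  have "higher_differentiable_on n (\<lambda>x. frechet_derivative (\<lambda>x. f x * g x) (at x) v) U" for v
  proof (rule higher_differentiable_on_cong[OF assms(1)])
    show "higher_differentiable_on n (\<lambda>x. f x * frechet_derivative g (at x) v
        + frechet_derivative f (at x) v * g x) U"
      using Suc.prems higher_differentiable_on_SucD[OF Suc.prems(1)]
        higher_differentiable_on_SucD[OF Suc.prems(2)]
      by (intro higher_differentiable_on_add[OF assms(1)] Suc.IH) auto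
  qed (use Suc.prems in \<open>auto simp: frechet_derivative_mult\<close>)
  then show ?case using Suc.prems by auto
qed

lemma higher_differentiable_on_const: "higher_differentiable_on n (\<lambda>x. c) U"
  by (induction n arbitrary: c) auto

lemma smooth_on_const [simp]: "smooth_on (\<lambda>x. c) U"
  by (simp add: smooth_on_def higher_differentiable_on_const)

lemma smooth_on_add: "open U \<Longrightarrow> smooth_on f U \<Longrightarrow> smooth_on g U \<Longrightarrow> smooth_on (\<lambda>x. f x + g x) U"
  by (simp add: smooth_on_def higher_differentiable_on_add)

lemma smooth_on_mult:
  fixes f g :: "'a::real_normed_vector \<Rightarrow> 'b::real_normed_algebra"
  shows "open U \<Longrightarrow> smooth_on f U \<Longrightarrow> smooth_on g U \<Longrightarrow> smooth_on (\<lambda>x. f x * g x) U"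
  by (simp add: smooth_on_def higher_differentiable_on_mult)

lemma smooth_on_cong:
  "open U \<Longrightarrow> (\<And>x. x \<in> U \<Longrightarrow> f x = g x) \<Longrightarrow> smooth_on f U \<Longrightarrow> smooth_on g U"
  unfolding smooth_on_def by (blast intro: higher_differentiable_on_cong)

lemma smooth_on_bounded_linear:
  assumes "bounded_linear f"
  shows "smooth_on f U"
proof -
  have D: "frechet_derivative f (at x) = f" for x
    by (rule frechet_derivative_at[symmetric]) (rule bounded_linear_imp_has_derivative[OF assms])
  have "higher_differentiable_on n f U" for n
    using assms bounded_linear_imp_differentiable
    by (cases n) (auto simp: D higher_differentiable_on_const linear_continuous_on)
  then show ?thesis by (simp add: smooth_on_def)
qed

section \<open>Directional derivatives in the complex plane\<close>

definition deriv_along :: "complex \<Rightarrow> (complex \<Rightarrow> real) \<Rightarrow> complex \<Rightarrow> real" where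
  "deriv_along v f z = frechet_derivative f (at z) v"

abbreviation "dx \<equiv> deriv_along 1"
abbreviation "dy \<equiv> deriv_along \<i>"

lemma smooth_on_differentiable:
  assumes "smooth_on f U" "x \<in> U" shows "f differentiable (at x)"
  using assms by (auto simp: smooth_on_def dest: spec[of _ "Suc 0"])

lemma smooth_on_deriv_along:
  assumes "smooth_on f U" shows "smooth_on (deriv_along v f) U"
  unfolding smooth_on_def deriv_along_def[abs_def]
proof
  fix n show "higher_differentiable_on n (\<lambda>x. frechet_derivative f (at x) v) U"
    using assms[unfolded smooth_on_def, rule_format, of "Suc n"] by simp
qed

lemma deriv_along_cong:
  assumes "open U" "x \<in> U" "\<And>y. y \<in> U \<Longrightarrow> f y = g y"
  shows "deriv_along v f x = deriv_along v g x"
  unfolding deriv_along_def by (simp add: frechet_derivative_cong_open[OF assms])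

lemma deriv_along_add:
  assumes "smooth_on f U" "smooth_on g U" "x \<in> U"
  shows "deriv_along v (\<lambda>x. f x + g x) x = deriv_along v f x + deriv_along v g x"
  unfolding deriv_along_def using assms
  by (simp add: frechet_derivative_add smooth_on_differentiable)

lemma deriv_along_mult:
  assumes "smooth_on f U" "smooth_on g U" "x \<in> U"
  shows "deriv_along v (\<lambda>x. f x * g x) x = f x * deriv_along v g x + deriv_along v f x * g x"
  unfolding deriv_along_def using assms
  by (simp add: frechet_derivative_mult smooth_on_differentiable)

lemma deriv_along_const [simp]: "deriv_along v (\<lambda>x. c) = (\<lambda>x. 0)"
  by (rule ext) (simp add: deriv_along_def)

lemma deriv_along_Re [simp]: "deriv_along v Re = (\<lambda>x. Re v)"
  using frechet_derivative_at[OF bounded_linear_imp_has_derivative[OF bounded_linear_Re]]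
  by (auto simp: deriv_along_def[abs_def])

lemma deriv_along_Im [simp]: "deriv_along v Im = (\<lambda>x. Im v)"
  using frechet_derivative_at[OF bounded_linear_imp_has_derivative[OF bounded_linear_Im]]
  by (auto simp: deriv_along_def[abs_def])

lemma smooth_on_Re_Im [simp]: "smooth_on Re U" "smooth_on Im U"
  by (simp_all add: smooth_on_bounded_linear bounded_linear_Re bounded_linear_Im)

lemma dx_dy_commute:
  assumes "open U" "z \<in> U" "smooth_on f U"
  shows "dx (dy f) z = dy (dx f) z"
  using mixed_derivatives_commute[OF assms, of \<i> 1] by (simp add: deriv_along_def[abs_def])

section \<open>The operator and its carre du champ in real coordinates\<close>

definition co_xx :: "complex \<Rightarrow> real" where
  "co_xx z = (1 + 2 * Re z - 3 * (Re z * Re z) + Im z * Im z) / 4"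
definition co_xy :: "complex \<Rightarrow> real" where
  "co_xy z = - (Im z + 2 * (Re z * Im z)) / 2"
definition co_yy :: "complex \<Rightarrow> real" where
  "co_yy z = (1 - 2 * Re z + Re z * Re z - 3 * (Im z * Im z)) / 4"

text \<open>With \<open>cnj z - z^2 = a + i b\<close> and \<open>m = (1 - |z|^2) / 4\<close>, the
  second-order terms collect to the coefficients \<open>m + a / 2\<close>, \<open>b / 2\<close> and
  \<open>m - a / 2\<close>.\<close>

lemma deltoid_op_eq:
  assumes U: "open U" "z \<in> U" and f: "smooth_on f U"
  shows "deltoid_op lam f z = co_xx z * dx (dx f) z + 2 * co_xy z * dy (dx f) z
    + co_yy z * dy (dy f) z - lam * (Re z * dx f z + Im z * dy f z)"
proof -
  define F where "F = (\<lambda>w. complex_of_real (f w))"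
  note d1 = smooth_on_differentiable[OF f]
  note d2 = smooth_on_differentiable[OF smooth_on_deriv_along[OF f] U(2)]
  have dz: "d_Z F w = (of_real (dx f w) + (- \<i>) * of_real (dy f w)) / 2"
    and db: "d_Zbar F w = (of_real (dx f w) + \<i> * of_real (dy f w)) / 2" if "w \<in> U" for w
    unfolding d_Z_def d_Zbar_def F_def deriv_along_def frechet_derivative_of_real_comp[OF d1[OF that]]
    by simp_all
  have D: "frechet_derivative (d_Z F) (at z) v =
      (of_real (deriv_along v (dx f) z) + (- \<i>) * of_real (deriv_along v (dy f) z)) / 2"
    "frechet_derivative (d_Zbar F) (at z) v =
      (of_real (deriv_along v (dx f) z) + \<i> * of_real (deriv_along v (dy f) z)) / 2" for v
    unfolding deriv_along_def[of v]
    by (rule fun_cong[OF frechet_derivative_complex_combination[OF U d2 d2]], erule dz)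
      (rule fun_cong[OF frechet_derivative_complex_combination[OF U d2 d2]], erule db)
  show ?thesis
    unfolding deltoid_op_def F_def[symmetric]
    unfolding deltoid_op_complex_def d_Z_def[of "d_Z F"] d_Z_def[of "d_Zbar F"]
      d_Zbar_def[of "d_Zbar F"] D dz[OF U(2)] db[OF U(2)] dx_dy_commute[OF U f]
    by (simp add: algebra_simps add_divide_distrib diff_divide_distrib power2_eq_square
        co_xx_def co_xy_def co_yy_def)
qed

definition gamma_form :: "(complex \<Rightarrow> real) \<Rightarrow> (complex \<Rightarrow> real) \<Rightarrow> complex \<Rightarrow> real" where
  "gamma_form f g z = co_xx z * (dx f z * dx g z)
     + co_xy z * (dx f z * dy g z + dy f z * dx g z) + co_yy z * (dy f z * dy g z)"

lemma deriv_along_deriv_along_add: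
  assumes "open U" "z \<in> U" "smooth_on f U" "smooth_on g U"
  shows "deriv_along w (deriv_along v (\<lambda>x. f x + g x)) z =
    deriv_along w (deriv_along v f) z + deriv_along w (deriv_along v g) z"
proof -
  have "deriv_along w (deriv_along v (\<lambda>x. f x + g x)) z =
      deriv_along w (\<lambda>x. deriv_along v f x + deriv_along v g x) z"
    using assms by (intro deriv_along_cong[of U]) (auto intro: deriv_along_add)
  then show ?thesis using assms by (simp add: deriv_along_add[of _ U] smooth_on_deriv_along)
qed

lemma deriv_along_deriv_along_mult:
  assumes "open U" "z \<in> U" "smooth_on f U" "smooth_on g U"
  shows "deriv_along w (deriv_along v (\<lambda>x. f x * g x)) z =
    f z * deriv_along w (deriv_along v g) z + deriv_along w f z * deriv_along v g z
    + deriv_along v f z * deriv_along w g z + deriv_along w (deriv_along v f) z * g z"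
proof -
  have "deriv_along w (deriv_along v (\<lambda>x. f x * g x)) z =
      deriv_along w (\<lambda>x. f x * deriv_along v g x + deriv_along v f x * g x) z"
    using assms by (intro deriv_along_cong[of U]) (auto intro: deriv_along_mult)
  then show ?thesis using assms
    by (simp add: deriv_along_add[of _ U] deriv_along_mult[of _ U] smooth_on_mult smooth_on_deriv_along)
qed

lemma deltoid_op_add:
  assumes "open U" "z \<in> U" "smooth_on f U" "smooth_on g U"
  shows "deltoid_op lam (\<lambda>x. f x + g x) z = deltoid_op lam f z + deltoid_op lam g z"
  using assms
  by (simp add: deltoid_op_eq[of U] smooth_on_add deriv_along_deriv_along_add[of U]
      deriv_along_add[of _ U] algebra_simps)

text \<open>The first-order part obeys the Leibniz rule, so only the second-order coefficients
  contribute to the excess. Hence the carre du champ does not depend on \<open>lam\<close>.\<close>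

lemma deltoid_op_mult:
  assumes "open U" "z \<in> U" "smooth_on f U" "smooth_on g U"
  shows "deltoid_op lam (\<lambda>x. f x * g x) z =
    f z * deltoid_op lam g z + g z * deltoid_op lam f z + 2 * gamma_form f g z"
  using assms
  by (simp add: deltoid_op_eq[of U] smooth_on_mult deriv_along_deriv_along_mult[of U]
      deriv_along_mult[of _ U] gamma_form_def algebra_simps)

lemma carre_du_champ_deltoid:
  assumes "open U" "z \<in> U" "smooth_on f U" "smooth_on g U"
  shows "carre_du_champ (deltoid_op lam) f g z = gamma_form f g z"
  by (simp add: carre_du_champ_def deltoid_op_mult[OF assms])

text \<open>Locality of the operator: in \<open>gamma2\<close> it acts on
  \<open>carre_du_champ\<close>, whose explicit form is available only on \<open>U\<close>.\<close>

lemma deltoid_op_cong: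
  assumes "open U" "z \<in> U" "smooth_on f U" "\<And>w. w \<in> U \<Longrightarrow> f w = g w"
  shows "deltoid_op lam f z = deltoid_op lam g z"
proof -
  have "deriv_along v f w = deriv_along v g w" if "w \<in> U" for v w
    using assms that by (intro deriv_along_cong[of U]) auto
  then have "deriv_along w (deriv_along v f) z = deriv_along w (deriv_along v g) z" for v w
    using assms by (intro deriv_along_cong[of U]) auto
  moreover have "smooth_on g U" using assms by (blast intro: smooth_on_cong)
  ultimately show ?thesis
    using assms \<open>\<And>v w. w \<in> U \<Longrightarrow> deriv_along v f w = deriv_along v g w\<close>
    by (simp add: deltoid_op_eq[of U])
qed

text \<open>Normal form built from constants, sums and products alone, the operations covered by the
  rules for smoothness and derivatives.\<close>

lemma co_eq_linear:
  "co_xx = (\<lambda>z. 1/4 + (1/2 * Re z + ((-3/4) * (Re z * Re z) + 1/4 * (Im z * Im z))))"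
  "co_xy = (\<lambda>z. (-1/2) * Im z + (-1) * (Re z * Im z))"
  "co_yy = (\<lambda>z. 1/4 + ((-1/2) * Re z + (1/4 * (Re z * Re z) + (-3/4) * (Im z * Im z))))"
  by (auto simp: fun_eq_iff co_xx_def co_xy_def co_yy_def field_simps)

lemma smooth_on_co:
  assumes "open U"
  shows "smooth_on co_xx U" "smooth_on co_xy U" "smooth_on co_yy U"
  unfolding co_eq_linear
  by (intro smooth_on_add smooth_on_mult smooth_on_const smooth_on_Re_Im assms)+

lemmas smooth_rules = smooth_on_add smooth_on_mult smooth_on_const smooth_on_Re_Im

lemma deriv_along_co:
  "deriv_along v co_xx z = (1/2 - 3/2 * Re z) * Re v + 1/2 * Im z * Im v"
  "deriv_along v co_xy z = - Im z * Re v + (-1/2 - Re z) * Im v"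
  "deriv_along v co_yy z = (-1/2 + 1/2 * Re z) * Re v - 3/2 * Im z * Im v"
  unfolding co_eq_linear
  by (simp_all only: deriv_along_add[of _ UNIV] deriv_along_mult[of _ UNIV]
      smooth_rules open_UNIV UNIV_I deriv_along_const deriv_along_Re deriv_along_Im)
    (simp_all add: algebra_simps)

lemma deltoid_op_co:
  "deltoid_op lam co_xx z = -3/2 * co_xx z + 1/2 * co_yy z
     - lam * (1/2 * Re z - 3/2 * (Re z * Re z) + 1/2 * (Im z * Im z))"
  "deltoid_op lam co_xy z = - 2 * co_xy z + lam * (1/2 * Im z + 2 * (Re z * Im z))"
  "deltoid_op lam co_yy z = 1/2 * co_xx z - 3/2 * co_yy z
     - lam * (- 1/2 * Re z + 1/2 * (Re z * Re z) - 3/2 * (Im z * Im z))"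
proof -
  \<comment> \<open>The coefficients are quadratic, so their first derivatives are affine. Writing
    those in one shape, zero coefficients included, lets a single rule give all second
    derivatives.\<close>
  have D: "deriv_along w (\<lambda>z. a + (b * Re z + c * Im z)) z = b * Re w + c * Im w" for a b c w
    by (simp only: deriv_along_add[of _ UNIV] deriv_along_mult[of _ UNIV]
      smooth_rules open_UNIV UNIV_I deriv_along_const deriv_along_Re deriv_along_Im)
  have 1: "dx co_xx = (\<lambda>z. 1/2 + ((-3/2) * Re z + 0 * Im z))" "dy co_xx = (\<lambda>z. 0 + (0 * Re z + 1/2 * Im z))"
    "dx co_xy = (\<lambda>z. 0 + (0 * Re z + (-1) * Im z))" "dy co_xy = (\<lambda>z. - 1/2 + ((-1) * Re z + 0 * Im z))"
    "dx co_yy = (\<lambda>z. - 1/2 + (1/2 * Re z + 0 * Im z))" "dy co_yy = (\<lambda>z. 0 + (0 * Re z + (-3/2) * Im z))"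
    by (simp_all add: deriv_along_co fun_eq_iff)
  show "deltoid_op lam co_xx z = -3/2 * co_xx z + 1/2 * co_yy z
     - lam * (1/2 * Re z - 3/2 * (Re z * Re z) + 1/2 * (Im z * Im z))"
   "deltoid_op lam co_xy z = - 2 * co_xy z + lam * (1/2 * Im z + 2 * (Re z * Im z))"
   "deltoid_op lam co_yy z = 1/2 * co_xx z - 3/2 * co_yy z
     - lam * (- 1/2 * Re z + 1/2 * (Re z * Re z) - 3/2 * (Im z * Im z))"
    unfolding deltoid_op_eq[OF open_UNIV UNIV_I smooth_on_co(1)[OF open_UNIV]]
      deltoid_op_eq[OF open_UNIV UNIV_I smooth_on_co(2)[OF open_UNIV]]
      deltoid_op_eq[OF open_UNIV UNIV_I smooth_on_co(3)[OF open_UNIV]] 1 D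
    by (simp_all add: algebra_simps)
qed

section \<open>The mixed Hessian and Bochner's formula\<close>

text \<open>
  Entries of the mixed Hessian (inverse metric times covariant Hessian). Raising one index makes
  the Christoffel terms affine in the coordinates, without the determinant as a denominator.
\<close>

definition hess_xx :: "(complex \<Rightarrow> real) \<Rightarrow> complex \<Rightarrow> real" where
  "hess_xx f z = co_xx z * dx (dx f) z + co_xy z * dy (dx f) z
     - ((3 * Re z - 1) * dx f z + Im z * dy f z) / 4"

definition hess_xy :: "(complex \<Rightarrow> real) \<Rightarrow> complex \<Rightarrow> real" where
  "hess_xy f z = co_xy z * dx (dx f) z + co_yy z * dy (dx f) z
     - (3 * Im z * dx f z + (1 - Re z) * dy f z) / 4"

definition hess_yx :: "(complex \<Rightarrow> real) \<Rightarrow> complex \<Rightarrow> real" where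
  "hess_yx f z = co_xx z * dy (dx f) z + co_xy z * dy (dy f) z
     - ((1 + 3 * Re z) * dy f z - Im z * dx f z) / 4"

definition hess_yy :: "(complex \<Rightarrow> real) \<Rightarrow> complex \<Rightarrow> real" where
  "hess_yy f z = co_xy z * dy (dx f) z + co_yy z * dy (dy f) z
     - ((1 + Re z) * dx f z + 3 * Im z * dy f z) / 4"

text \<open>Contribution of the drift \<open>- (lam - 1) u\<close>, divided by
  \<open>lam - 1\<close>: \<open>gamma_form f f\<close> minus half the Euler derivative of its
  coefficients. This weights their part of degree \<open>d\<close> by \<open>1 - d / 2\<close> and
  so removes the quadratic part.\<close>

definition ric_form :: "(complex \<Rightarrow> real) \<Rightarrow> complex \<Rightarrow> real" where
  "ric_form f z = ((1 + Re z) * (dx f z)\<^sup>2 - 2 * Im z * dx f z * dy f z + (1 - Re z) * (dy f z)\<^sup>2) / 4"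

text \<open>The third derivatives of \<open>f\<close> cancel. What remains is quadratic in the
  second derivatives, and completing the square turns it into the trace of the squared mixed Hessian
  plus a form in the gradient.\<close>

lemma gamma2_deltoid:
  assumes U: "open U" "z \<in> U" and f: "smooth_on f U"
  shows "gamma2 (deltoid_op lam) f z =
    (hess_xx f z)\<^sup>2 + 2 * hess_xy f z * hess_yx f z + (hess_yy f z)\<^sup>2 + (lam - 1) * ric_form f z"
proof -
  define p q r s t A B C where "p = dx f z" and "q = dy f z"
    and "r = dx (dx f) z" and "s = dy (dx f) z" and "t = dy (dy f) z"
    and "A = co_xx z" and "B = co_xy z" and "C = co_yy z"
  note defs = this
  have sm: "smooth_on (dx f) U" "smooth_on (dy f) U" "smooth_on (dx (dx f)) U"
    "smooth_on (dy (dx f)) U" "smooth_on (dy (dy f)) U"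
    by (intro smooth_on_deriv_along f)+
  note co = smooth_on_co[OF U(1)]
  let ?G = "\<lambda>w. co_xx w * (dx f w * dx f w)
    + ((co_xy w * (dx f w * dy f w) + co_xy w * (dx f w * dy f w)) + co_yy w * (dy f w * dy f w))"
  have smG: "smooth_on ?G U" by (intro smooth_on_add smooth_on_mult sm co U)
  have "gamma_form f f w = ?G w" if "w \<in> U" for w
    by (simp add: gamma_form_def algebra_simps)
  then have carre: "?G w = carre_du_champ (deltoid_op lam) f f w" if "w \<in> U" for w
    unfolding carre_du_champ_deltoid[OF U(1) that f f] using that by metis
  have LG: "deltoid_op lam (carre_du_champ (deltoid_op lam) f f) z = deltoid_op lam ?G z"
    by (rule deltoid_op_cong[OF U smG carre, symmetric])
  let ?L = "\<lambda>w. co_xx w * dx (dx f) w + ((co_xy w * dy (dx f) w + co_xy w * dy (dx f) w)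
    + (co_yy w * dy (dy f) w + (- lam) * (Re w * dx f w + Im w * dy f w)))"
  have smL: "smooth_on ?L U" by (intro smooth_on_add smooth_on_mult sm co U smooth_on_Re_Im smooth_on_const)
  have eqL: "deltoid_op lam f w = ?L w" if "w \<in> U" for w
    using deltoid_op_eq[OF U(1) that f] by (simp add: algebra_simps)
  have smLf: "smooth_on (deltoid_op lam f) U"
    by (rule smooth_on_cong[OF U(1) eqL[symmetric] smL])
  have DL: "deriv_along v (deltoid_op lam f) z = deriv_along v ?L z" for v
    by (rule deriv_along_cong[OF U eqL])
  \<comment> \<open>Mixed derivatives are brought to one order, \<open>dx\<close> applied before
    \<open>dy\<close>, so that the third-order terms cancel literally.\<close>
  have c1: "dx (dy f) w = dy (dx f) w" if "w \<in> U" for w by (rule dx_dy_commute[OF U(1) that f])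
  have c2: "deriv_along v (dx (dy f)) z = deriv_along v (dy (dx f)) z" for v
    by (rule deriv_along_cong[OF U c1])
  have c3: "dx (dy (dx f)) z = dy (dx (dx f)) z" by (rule dx_dy_commute[OF U sm(1)])
  have c4: "dx (dy (dy f)) z = dy (dy (dx f)) z" using dx_dy_commute[OF U sm(2)] c2 by simp
  have LG': "deltoid_op lam ?G z =
     A * (2 * p * deltoid_op lam (dx f) z + 2 * (A * r\<^sup>2 + 2 * B * r * s + C * s\<^sup>2))
     + p\<^sup>2 * deltoid_op lam co_xx z + 4 * p * gamma_form co_xx (dx f) z
     + 2 * B * (p * deltoid_op lam (dy f) z + q * deltoid_op lam (dx f) z
        + 2 * (A * r * s + B * (r * t + s\<^sup>2) + C * s * t))
     + 2 * p * q * deltoid_op lam co_xy z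
     + 4 * (p * gamma_form co_xy (dy f) z + q * gamma_form co_xy (dx f) z)
     + C * (2 * q * deltoid_op lam (dy f) z + 2 * (A * s\<^sup>2 + 2 * B * s * t + C * t\<^sup>2))
     + q\<^sup>2 * deltoid_op lam co_yy z + 4 * q * gamma_form co_yy (dy f) z"
    apply (simp only: deltoid_op_add[OF U] deltoid_op_mult[OF U] sm co
        smooth_on_add[OF U(1)] smooth_on_mult[OF U(1)])
    apply (simp only: gamma_form_def deriv_along_mult[of _ U] sm U c1)
    unfolding defs[symmetric]
    by (simp only: algebra_simps power2_eq_square)
  have DL': "deriv_along v (deltoid_op lam f) z =
     A * deriv_along v (dx (dx f)) z + deriv_along v co_xx z * r
     + 2 * (B * deriv_along v (dy (dx f)) z + deriv_along v co_xy z * s)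
     + C * deriv_along v (dy (dy f)) z + deriv_along v co_yy z * t
     - lam * (Re v * p + Re z * deriv_along v (dx f) z + Im v * q + Im z * deriv_along v (dy f) z)" for v
    unfolding DL
    apply (simp only: deriv_along_add[of _ U] deriv_along_mult[of _ U] sm co U smooth_rules
        deriv_along_Re deriv_along_Im deriv_along_const)
    unfolding defs[symmetric]
    by (simp only: algebra_simps) simp
  have Lp: "deltoid_op lam (dx f) z = A * dx (dx (dx f)) z + 2 * B * dy (dx (dx f)) z + C * dy (dy (dx f)) z
     - lam * (Re z * r + Im z * s)"
    unfolding deltoid_op_eq[OF U sm(1)] A_def B_def C_def r_def s_def ..
  have Lq: "deltoid_op lam (dy f) z = A * dy (dx (dx f)) z + 2 * B * dy (dy (dx f)) z + C * dy (dy (dy f)) z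
     - lam * (Re z * s + Im z * t)"
    unfolding deltoid_op_eq[OF U sm(2)] A_def B_def C_def t_def s_def c1[OF U(2)] c2 c3 ..
  let ?x = "Re z" and ?y = "Im z"
  \<comment> \<open>The Christoffel part of the mixed Hessian, which is the inverse metric times the
    matrix of second derivatives, minus \<open>N\<close>.\<close>
  define N11 N12 N21 N22 where "N11 = ((3 * ?x - 1) * p + ?y * q) / 4"
    and "N12 = (3 * ?y * p + (1 - ?x) * q) / 4" and "N21 = ((1 + 3 * ?x) * q - ?y * p) / 4"
    and "N22 = ((1 + ?x) * p + 3 * ?y * q) / 4"
  note N_defs = this
  have "gamma2 (deltoid_op lam) f z =
      A\<^sup>2 * r\<^sup>2 + 4 * A * B * r * s + 2 * B\<^sup>2 * r * t + 2 * (A * C + B\<^sup>2) * s\<^sup>2 + 4 * B * C * s * t + C\<^sup>2 * t\<^sup>2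
    - 2 * ((- p * (A * (1 - 3 * ?x) + B * ?y) / 4
         + q * (A * ?y + B * (1/2 + ?x) + B * (1 - 3 * ?x) / 4 + C * ?y / 4)) * r
      + 2 * (- p * (B * (1 - 3 * ?x) + C * ?y) / 4 + q * (A * (1 - ?x) + 3 * B * ?y) / 4) * s
      + (q * (B * (1 - ?x) + 3 * C * ?y) / 4
         + p * (B * ?y + C * (1/2 + ?x) - A * (1 - ?x) / 4 - 3 * B * ?y / 4)) * t)
    + ((p\<^sup>2 * deltoid_op lam co_xx z + 2 * p * q * deltoid_op lam co_xy z + q\<^sup>2 * deltoid_op lam co_yy z) / 2
       + lam * (A * p\<^sup>2 + 2 * B * p * q + C * q\<^sup>2))"
    unfolding gamma2_def LG LG' carre_du_champ_deltoid[OF U f smLf] gamma_form_def DL' Lp Lq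
      c1[OF U(2)] c2 c3 c4 deriv_along_co defs[symmetric]
    by (simp add: algebra_simps add_divide_distrib diff_divide_distrib power2_eq_square)
  \<comment> \<open>The coefficients of \<open>r\<close>, \<open>s\<close> and \<open>t\<close> are
    those of the cross terms in the trace of the square.\<close>
  moreover have "- p * (A * (1 - 3 * ?x) + B * ?y) / 4
         + q * (A * ?y + B * (1/2 + ?x) + B * (1 - 3 * ?x) / 4 + C * ?y / 4) = A * N11 + B * N21"
    "2 * (- p * (B * (1 - 3 * ?x) + C * ?y) / 4 + q * (A * (1 - ?x) + 3 * B * ?y) / 4)
       = (A * N12 + B * N22) + (B * N11 + C * N21)"
    "q * (B * (1 - ?x) + 3 * C * ?y) / 4
         + p * (B * ?y + C * (1/2 + ?x) - A * (1 - ?x) / 4 - 3 * B * ?y / 4) = B * N12 + C * N22"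
    unfolding N_defs A_def B_def C_def co_xx_def co_xy_def co_yy_def
    by (simp_all add: algebra_simps add_divide_distrib diff_divide_distrib)
  \<comment> \<open>Flatness enters here: for \<open>lam = 1\<close> the part quadratic in the
    gradient is exactly the trace of \<open>N\<close> squared, without a Ricci term.\<close>
  moreover have "(p\<^sup>2 * deltoid_op lam co_xx z + 2 * p * q * deltoid_op lam co_xy z + q\<^sup>2 * deltoid_op lam co_yy z) / 2
       + lam * (A * p\<^sup>2 + 2 * B * p * q + C * q\<^sup>2)
      = N11\<^sup>2 + 2 * N12 * N21 + N22\<^sup>2 + (lam - 1) * ric_form f z"
    unfolding N_defs ric_form_def deltoid_op_co defs[symmetric]
    unfolding A_def B_def C_def co_xx_def co_xy_def co_yy_def
    by (simp add: algebra_simps add_divide_distrib diff_divide_distrib power2_eq_square)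
  ultimately have "gamma2 (deltoid_op lam) f z =
      A\<^sup>2 * r\<^sup>2 + 4 * A * B * r * s + 2 * B\<^sup>2 * r * t + 2 * (A * C + B\<^sup>2) * s\<^sup>2 + 4 * B * C * s * t + C\<^sup>2 * t\<^sup>2
    - 2 * ((A * N11 + B * N21) * r + ((A * N12 + B * N22) + (B * N11 + C * N21)) * s + (B * N12 + C * N22) * t)
    + (N11\<^sup>2 + 2 * N12 * N21 + N22\<^sup>2 + (lam - 1) * ric_form f z)"
    by simp
  also have "\<dots> = (A * r + B * s - N11)\<^sup>2 + 2 * (B * r + C * s - N12) * (A * s + B * t - N21)
      + (B * s + C * t - N22)\<^sup>2 + (lam - 1) * ric_form f z"
    by (simp add: power2_eq_square algebra_simps)
  finally show ?thesis
    unfolding hess_xx_def hess_xy_def hess_yx_def hess_yy_def defs[symmetric] N_defs .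
qed

section \<open>Ellipticity and the positive terms\<close>

text \<open>For coefficients \<open>m + a / 2\<close>, \<open>b / 2\<close>,
  \<open>m - a / 2\<close> the determinant is \<open>m^2 - (a^2 + b^2) / 4\<close>, a quarter of the
  defining polynomial of the domain.\<close>

lemma symbol_det_eq: "co_xx z * co_yy z - (co_xy z)\<^sup>2 = deltoid_poly z / 4"
proof -
  have "(cmod z)^4 = ((cmod z)\<^sup>2)\<^sup>2" by simp
  then show ?thesis
    unfolding deltoid_poly_alt cmod_power2
    by (simp add: co_xx_def co_xy_def co_yy_def power2_eq_square power3_eq_cube field_simps)
qed

text \<open>The bound is the value at the real point \<open>cmod z\<close>, where the polynomial has
  a triple root at the cusp \<open>1\<close>. It confines the domain to the unit disc.\<close>

lemma deltoid_poly_le: "deltoid_poly z \<le> 3/4 * (1 - cmod z)^3 * (cmod z + 1/3)"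
proof -
  have "Re (z^3) \<le> (cmod z)^3"
    by (metis complex_Re_le_cmod norm_power)
  moreover have "3/4 * (1 - r)^3 * (r + 1/3) = 1/4 - 3/2 * r^2 - 3/4 * r^4 + 2 * r^3" for r :: real
    by (simp add: power2_eq_square power3_eq_cube power4_eq_xxxx algebra_simps
        add_divide_distrib diff_divide_distrib)
  ultimately show ?thesis
    unfolding deltoid_poly_alt by simp
qed

text \<open>The determinant is positive by the choice of domain and the trace
  \<open>(1 - |z|^2) / 2\<close> is positive in the unit disc, so both diagonal entries are
  positive.\<close>

lemma deltoid_domain_elliptic:
  assumes "z \<in> deltoid_domain"
  shows "co_xx z * co_yy z - (co_xy z)\<^sup>2 > 0" "co_xx z > 0" "co_yy z > 0"
proof -
  have P: "deltoid_poly z > 0" using assms by (simp add: deltoid_domain_eq)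
  then show g: "co_xx z * co_yy z - (co_xy z)\<^sup>2 > 0" by (simp add: symbol_det_eq)
  have "0 < 3/4 * (1 - cmod z)^3 * (cmod z + 1/3)"
    by (rule less_le_trans[OF P deltoid_poly_le])
  moreover have "cmod z + 1/3 > 0" by (rule add_nonneg_pos) auto
  ultimately have "(1 - cmod z)^3 > 0"
    by (simp add: zero_less_mult_iff)
  then have "cmod z < 1" by (simp add: zero_less_power_eq)
  then have "(cmod z)\<^sup>2 < 1" by (simp add: abs_square_less_1)
  moreover have "co_xx z + co_yy z = (1 - (cmod z)\<^sup>2) / 2"
    unfolding cmod_power2 by (simp add: co_xx_def co_yy_def power2_eq_square field_simps)
  ultimately have "co_xx z + co_yy z > 0" by simp
  moreover have "co_xx z * co_yy z > 0"
    using g zero_le_power2[of "co_xy z"] by linarith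
  ultimately show "co_xx z > 0" "co_yy z > 0"
    by (auto simp: zero_less_mult_iff)
qed

text \<open>Each summand has its own use: the square pays for the dimension term,
  \<open>3/4 * gamma_form\<close> yields the curvature constant, and the adjugate form is discarded
  as nonnegative.\<close>

lemma ric_form_eq:
  "ric_form f z = (Re z * dx f z + Im z * dy f z)\<^sup>2 / 2 + 3/4 * gamma_form f f z
     + (co_yy z * (dx f z)\<^sup>2 - 2 * co_xy z * dx f z * dy f z + co_xx z * (dy f z)\<^sup>2) / 4"
  unfolding ric_form_def gamma_form_def co_xx_def co_xy_def co_yy_def
  by (simp add: algebra_simps add_divide_distrib diff_divide_distrib power2_eq_square)

text \<open>The two sides are the off-diagonal entries of the Hessian with both indices raised, a
  symmetric matrix.\<close>

lemma hess_sym: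
  "co_xx z * hess_xy f z + co_xy z * hess_yy f z = co_xy z * hess_xx f z + co_yy z * hess_yx f z"
proof -
  have *: "co_xx z * (3 * Im z * p + (1 - Re z) * q) + co_xy z * ((1 + Re z) * p + 3 * Im z * q)
    = co_xy z * ((3 * Re z - 1) * p + Im z * q) + co_yy z * ((1 + 3 * Re z) * q - Im z * p)" for p q
    unfolding co_xx_def co_xy_def co_yy_def
    by (simp add: algebra_simps add_divide_distrib diff_divide_distrib)
  show ?thesis
    using *[of "dx f z" "dy f z"] unfolding hess_xx_def hess_xy_def hess_yx_def hess_yy_def
    by (simp add: algebra_simps add_divide_distrib diff_divide_distrib)
qed

text \<open>A matrix self-adjoint for a positive definite form has real eigenvalues, so its
  characteristic polynomial has nonnegative discriminant, which equals
  \<open>2 tr (W^2) - (tr W)^2\<close>.\<close>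

lemma symmetric_discriminant_nonneg:
  fixes A B C :: real
  assumes "A > 0" "C > 0" "A * C - B\<^sup>2 > 0" and sym: "A * b + B * d = B * a + C * c"
  shows "(a - d)\<^sup>2 + 4 * b * c \<ge> 0"
proof -
  have s: "A * b - C * c = B * (a - d)" using sym by (simp add: algebra_simps)
  have "A * C * ((a - d)\<^sup>2 + 4 * b * c) = (A * C - B\<^sup>2) * (a - d)\<^sup>2 + (B * (a - d))\<^sup>2 + 4 * (A * b) * (C * c)"
    by (simp add: power2_eq_square algebra_simps)
  also have "\<dots> = (A * C - B\<^sup>2) * (a - d)\<^sup>2 + (A * b + C * c)\<^sup>2"
    unfolding s[symmetric] by (simp add: power2_eq_square algebra_simps)
  also have "\<dots> \<ge> 0" using assms by simp
  finally show ?thesis using mult_pos_pos[OF assms(1,2)] by (simp only: zero_le_mult_iff) linarith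
qed

lemma psd_form_nonneg:
  fixes A B C :: real
  assumes "A > 0" "A * C - B\<^sup>2 > 0"
  shows "A * q\<^sup>2 - 2 * B * p * q + C * p\<^sup>2 \<ge> 0"
proof -
  have "A * (A * q\<^sup>2 - 2 * B * p * q + C * p\<^sup>2) = (A * q - B * p)\<^sup>2 + (A * C - B\<^sup>2) * p\<^sup>2"
    by (simp add: power2_eq_square algebra_simps)
  also have "\<dots> \<ge> 0" using assms by simp
  finally show ?thesis using assms by (simp add: zero_le_mult_iff)
qed

section \<open>The curvature-dimension inequality\<close>

lemma deltoid_op_eq_hess:
  assumes "open U" "z \<in> U" "smooth_on f U"
  shows "deltoid_op lam f z = hess_xx f z + hess_yy f z - (lam - 1) * (Re z * dx f z + Im z * dy f z)"
  unfolding deltoid_op_eq[OF assms] hess_xx_def hess_yy_def by (simp add: algebra_simps add_divide_distrib diff_divide_distrib)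

lemma deltoid_CD_two_lam:
  assumes "lam > 1"
  shows "deltoid_CD lam (3 * (lam - 1) / 4) (ereal (2 * lam))"
  unfolding deltoid_CD_def
proof (intro ballI)
  fix f z assume "f \<in> deltoid_test_functions" and z: "z \<in> deltoid_domain"
  then obtain U where U: "open U" "closure deltoid_domain \<subseteq> U" "smooth_on f U"
    by (auto simp: deltoid_test_functions_def)
  have zU: "z \<in> U" using z U(2) closure_subset by blast
  define a b c d where "a = hess_xx f z" and "b = hess_xy f z" and "c = hess_yx f z" and "d = hess_yy f z"
  note h = this
  define u where "u = Re z * dx f z + Im z * dy f z"
  define N where "N = (co_yy z * (dx f z)\<^sup>2 - 2 * co_xy z * dx f z * dy f z + co_xx z * (dy f z)\<^sup>2) / 4"
  note el = deltoid_domain_elliptic[OF z]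
  have disc: "(a - d)\<^sup>2 + 4 * b * c \<ge> 0" unfolding h
    by (rule symmetric_discriminant_nonneg[OF el(2,3) el(1) hess_sym])
  have N: "N \<ge> 0"
    unfolding N_def using psd_form_nonneg[OF el(2) el(1), of "dy f z" "dx f z"] by simp
  have G: "carre_du_champ (deltoid_op lam) f f z = gamma_form f f z"
    by (rule carre_du_champ_deltoid[OF U(1) zU U(3) U(3)])
  have ric: "ric_form f z = u\<^sup>2 / 2 + 3/4 * gamma_form f f z + N"
    unfolding ric_form_eq u_def N_def ..
  have inv: "real_of_ereal (1 / ereal (2 * lam)) = 1 / (2 * lam)"
    using assms by (simp add: one_ereal_def)
  \<comment> \<open>The first summand on the right is the defect in
    \<open>tr (W^2) >= (tr W)^2 / 2\<close>. The second is \<open>lam / 2\<close> times the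
    convexity defect of the square at \<open>tr W\<close> and \<open>- u\<close> with weights
    \<open>1 / lam\<close> and \<open>1 - 1 / lam\<close>.\<close>
  have "a\<^sup>2 + 2 * b * c + d\<^sup>2 + (lam - 1) * u\<^sup>2 / 2 - 1 / (2 * lam) * (a + d - (lam - 1) * u)\<^sup>2
     = ((a - d)\<^sup>2 + 4 * b * c) / 2 + (lam - 1) / (2 * lam) * (a + d + u)\<^sup>2"
    using assms by (simp add: field_simps power2_eq_square)
  moreover have "\<dots> \<ge> 0" using disc assms by simp
  moreover have "(lam - 1) * N \<ge> 0" using N assms by simp
  ultimately have "a\<^sup>2 + 2 * b * c + d\<^sup>2 + (lam - 1) * (u\<^sup>2 / 2 + 3/4 * gamma_form f f z + N)
      \<ge> 3 * (lam - 1) / 4 * gamma_form f f z + 1 / (2 * lam) * (a + d - (lam - 1) * u)\<^sup>2"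
    by (simp add: algebra_simps)
  then show "gamma2 (deltoid_op lam) f z \<ge> 3 * (lam - 1) / 4 * carre_du_champ (deltoid_op lam) f f z
      + real_of_ereal (1 / ereal (2 * lam)) * (deltoid_op lam f z)\<^sup>2"
    unfolding G inv gamma2_deltoid[OF U(1) zU U(3)] deltoid_op_eq_hess[OF U(1) zU U(3)] ric
    unfolding h u_def .
qed

section \<open>Jets on the real axis, and sharpness\<close>

lemma real_axis_deltoid_domain:
  assumes "- 1/3 < x" "x < 1"
  shows "complex_of_real x \<in> deltoid_domain"
proof -
  have "deltoid_poly (of_real x) = (1 - x)^3 * (1 + 3 * x) / 4"
    unfolding deltoid_poly_alt of_real_power[symmetric] by (simp add: power2_eq_square power3_eq_cube power4_eq_xxxx algebra_simps)
  also have "\<dots> > 0" using assms by simp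
  finally show ?thesis by (simp add: deltoid_domain_eq)
qed

text \<open>At a given point the inequality involves only derivatives of order one and two, so
  quadratic polynomials centred there turn it into a condition on five free numbers.\<close>

lemma ex_jet:
  "\<exists>f. smooth_on f UNIV \<and> dx f z = p \<and> dy f z = q \<and> dx (dx f) z = r \<and> dy (dx f) z = s \<and> dy (dy f) z = t"
proof -
  define X Y where "X = (\<lambda>w. Re w + - Re z)" and "Y = (\<lambda>w. Im w + - Im z)"
  have sm: "smooth_on X UNIV" "smooth_on Y UNIV"
    unfolding X_def Y_def by (intro smooth_rules open_UNIV)+
  have D: "deriv_along v X w = Re v" "deriv_along v Y w = Im v" for v w
    unfolding X_def Y_def
    by (simp_all only: deriv_along_add[of _ UNIV] smooth_rules UNIV_I deriv_along_const
        deriv_along_Re deriv_along_Im add_0_right)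
  define f where "f = (\<lambda>w. (p * X w + q * Y w)
      + ((r/2 * (X w * X w) + s * (X w * Y w)) + t/2 * (Y w * Y w)))"
  have smf: "smooth_on f UNIV" unfolding f_def by (intro smooth_rules open_UNIV sm)
  have D1: "deriv_along v f = (\<lambda>w. (p * Re v + q * Im v)
      + ((r * Re v + s * Im v) * X w + (s * Re v + t * Im v) * Y w))" for v
    unfolding f_def
    by (rule ext, simp only: deriv_along_add[of _ UNIV] deriv_along_mult[of _ UNIV] smooth_rules sm
        open_UNIV UNIV_I D deriv_along_const) (simp add: algebra_simps)
  have D2: "deriv_along v' (deriv_along v f) w =
      (r * Re v + s * Im v) * Re v' + (s * Re v + t * Im v) * Im v'" for v v' w
    unfolding D1
    by (simp add: deriv_along_add[of _ UNIV] deriv_along_mult[of _ UNIV] smooth_on_add smooth_on_mult sm D)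
  have "dx f z = p \<and> dy f z = q \<and> dx (dx f) z = r \<and> dy (dx f) z = s \<and> dy (dy f) z = t"
    unfolding D2 unfolding D1
    by (simp add: X_def Y_def)
  with smf show ?thesis by blast
qed

text \<open>On the real axis the inverse metric is diagonal with entries \<open>A\<close> and
  \<open>C\<close>. \<open>A\<close> vanishes at \<open>- 1/3\<close>, and both vanish at
  \<open>1\<close>.\<close>

lemma deltoid_CD_real_axis:
  fixes x p q r s t
  assumes CD: "deltoid_CD lam \<rho> n" and x: "- 1/3 < x" "x < 1"
  defines "A \<equiv> (1 - x) * (1 + 3 * x) / 4" and "C \<equiv> (1 - x)\<^sup>2 / 4"
  shows "\<rho> * (A * p\<^sup>2 + C * q\<^sup>2) + real_of_ereal (1 / n) * (A * r + C * t - lam * x * p)\<^sup>2 \<le>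
    (A * r - (3 * x - 1) * p / 4)\<^sup>2 + 2 * (C * s - (1 - x) * q / 4) * (A * s - (1 + 3 * x) * q / 4)
     + (C * t - (1 + x) * p / 4)\<^sup>2 + (lam - 1) * ((1 + x) * p\<^sup>2 + (1 - x) * q\<^sup>2) / 4"
proof -
  define z where "z = complex_of_real x"
  have z: "z \<in> deltoid_domain" unfolding z_def by (rule real_axis_deltoid_domain[OF x])
  obtain f where f: "smooth_on f UNIV"
    and j: "dx f z = p" "dy f z = q" "dx (dx f) z = r" "dy (dx f) z = s" "dy (dy f) z = t"
    using ex_jet by blast
  have "f \<in> deltoid_test_functions" using f by (auto simp: deltoid_test_functions_def)
  then have *: "\<rho> * carre_du_champ (deltoid_op lam) f f z + real_of_ereal (1 / n) * (deltoid_op lam f z)\<^sup>2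
      \<le> gamma2 (deltoid_op lam) f z"
    using CD z by (simp add: deltoid_CD_def)
  have ABC: "co_xx z = A" "co_xy z = 0" "co_yy z = C" and xy: "Re z = x" "Im z = 0"
    by (simp_all add: z_def A_def C_def co_xx_def co_xy_def co_yy_def power2_eq_square algebra_simps)
  show ?thesis
    using * unfolding carre_du_champ_deltoid[OF open_UNIV UNIV_I f f] deltoid_op_eq[OF open_UNIV UNIV_I f]
      gamma2_deltoid[OF open_UNIV UNIV_I f] gamma_form_def hess_xx_def hess_xy_def hess_yx_def hess_yy_def
      ric_form_def j ABC xy
    by (simp add: power2_eq_square mult.assoc)
qed

text \<open>The obstructions sit at boundary points, where no test is allowed. The jets may blow up
  there, so the limit is taken in the simplified inequality.\<close>

lemma nonneg_at_endpoint:
  fixes g :: "real \<Rightarrow> real"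
  assumes "continuous_on {a..b} g" "a < b" "\<And>x. a < x \<Longrightarrow> x < b \<Longrightarrow> g x \<ge> 0" "x \<in> {a..b}"
  shows "g x \<ge> 0"
  using continuous_ge_on_closure[of "{a<..<b}" g x 0] assms by simp

theorem proposition4p4:
  fixes lam :: real
  assumes "lam > 0"
  shows "(lam < 1 \<longrightarrow> \<not> (\<exists>\<rho>. deltoid_CD lam \<rho> \<infinity>)) \<and>
    (lam > 1 \<longrightarrow>
      (\<forall>n \<rho>. 1 \<le> n \<and> n < ereal (2 * lam) \<longrightarrow> \<not> deltoid_CD lam \<rho> n) \<and>
      deltoid_CD lam (3 * (lam - 1) / 4) (ereal (2 * lam)) \<and>
      (\<forall>\<rho>. deltoid_CD lam \<rho> (ereal (2 * lam)) \<longrightarrow> \<rho> \<le> 3 * (lam - 1) / 4))"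
proof (intro conjI impI allI notI)
  assume "lam < 1" and "\<exists>\<rho>. deltoid_CD lam \<rho> \<infinity>"
  then obtain \<rho> where CD: "deltoid_CD lam \<rho> \<infinity>" by blast
  \<comment> \<open>a jet with vanishing Hessian and gradient along the degenerate direction\<close>
  have "(lam - 1) * (1 + x) / 4 - \<rho> * ((1 - x) * (1 + 3 * x) / 4) \<ge> 0" if x: "-1/3 < x" "x < 1" for x
  proof -
    define A C where "A = (1 - x) * (1 + 3 * x) / 4" and "C = (1 - x)\<^sup>2 / 4"
    have "A \<noteq> 0" "C \<noteq> 0" using x by (auto simp: A_def C_def)
    then show ?thesis
      \<comment> \<open>\<open>r\<close> and \<open>t\<close> solve \<open>hess_xx = 0\<close> and
        \<open>hess_yy = 0\<close> for \<open>p = 1\<close>. The term in \<open>L f\<close> drops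
        out because \<open>1 / n\<close> is zero.\<close>
      using deltoid_CD_real_axis[OF CD x, of 1 0 "(3 * x - 1) / (4 * A)" "(1 + x) / (4 * C)" 0]
      unfolding A_def[symmetric] C_def[symmetric] by simp
  qed
  \<comment> \<open>The coefficient of \<open>\<rho>\<close> vanishes at \<open>- 1/3\<close>, which
    leaves \<open>(lam - 1) / 6 >= 0\<close>.\<close>
  then have "(lam - 1) * (1 + (-1/3)) / 4 - \<rho> * ((1 - (-1/3)) * (1 + 3 * (-1/3)) / 4) \<ge> 0"
    by (rule nonneg_at_endpoint[where a = "-1/3" and b = 1, rotated 2]) (auto intro!: continuous_intros)
  with \<open>lam < 1\<close> show False by simp
next
  fix n \<rho> assume "lam > 1" and n: "1 \<le> n \<and> n < ereal (2 * lam)" and CD: "deltoid_CD lam \<rho> n"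
  then obtain m where m: "n = ereal m" "1 \<le> m" "m < 2 * lam"
    by (cases n) (auto simp: one_ereal_def)
  \<comment> \<open>the function \<open>Re\<close>, tested at the cusp\<close>
  define g where "g = (\<lambda>x. (3 * x - 1)\<^sup>2 / 16 + (1 + x)\<^sup>2 / 16 + (lam - 1) * (1 + x) / 4
    - \<rho> * ((1 - x) * (1 + 3 * x) / 4) - 1 / m * (lam * x)\<^sup>2)"
  have "m \<noteq> 0" using m by simp
  have "g x \<ge> 0" if x: "-1/3 < x" "x < 1" for x
    using deltoid_CD_real_axis[OF CD x, of 1 0 0 0 0] m
    by (simp add: g_def one_ereal_def power_divide)
  then have "g 1 \<ge> 0"
    by (rule nonneg_at_endpoint[where a = "-1/3" and b = 1, rotated 2])
      (use \<open>m \<noteq> 0\<close> in \<open>auto simp: g_def intro!: continuous_intros\<close>)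
  \<comment> \<open>At the cusp \<open>\<rho>\<close> drops out. The limit of \<open>gamma2\<close>
    is \<open>lam / 2\<close> and that of \<open>L f\<close> is \<open>- lam\<close>, which forces
    \<open>m >= 2 * lam\<close>.\<close>
  moreover have "g 1 = lam / 2 - lam\<^sup>2 / m" by (simp add: g_def diff_divide_distrib)
  ultimately have "lam\<^sup>2 / m \<le> lam / 2" by simp
  with m \<open>lam > 0\<close> show False by (simp add: field_simps power2_eq_square)
next
  fix \<rho> assume "lam > 1" and CD: "deltoid_CD lam \<rho> (ereal (2 * lam))"
  \<comment> \<open>a jet with vanishing Hessian and gradient tangent to the boundary at \<open>- 1/3\<close>\<close>
  define g where "g = (\<lambda>x. (lam - 1) * (1 - x) / 4 - \<rho> * ((1 - x)\<^sup>2 / 4))"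
  have "g x \<ge> 0" if x: "-1/3 < x" "x < 1" for x
  proof -
    \<comment> \<open>This value makes \<open>hess_xy\<close> vanish, and \<open>hess_yx\<close>
      with it. As \<open>p = r = t = 0\<close>, also \<open>L f = 0\<close>, so the dimension term
      gives nothing.\<close>
    define s where "s = 1 / (1 - x)"
    have "d\<^sup>2 / 4 * (1 / d) = d / 4" if "d \<noteq> 0" for d :: real
      using that by (simp add: power2_eq_square)
    from this[of "1 - x"] have s: "(1 - x)\<^sup>2 / 4 * s = (1 - x) / 4"
      unfolding s_def using x by linarith
    show ?thesis
      using deltoid_CD_real_axis[OF CD x, of 0 1 0 0 s] unfolding s by (simp add: g_def)
  qed
  \<comment> \<open>The condition \<open>\<rho> <= (lam - 1) / (1 - x)\<close> is strongest at the
    left endpoint.\<close>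
  then have "g (-1/3) \<ge> 0"
    by (rule nonneg_at_endpoint[where a = "-1/3" and b = 1, rotated 2]) (auto simp: g_def intro!: continuous_intros)
  then show "\<rho> \<le> 3 * (lam - 1) / 4" by (simp add: g_def power2_eq_square field_simps)
qed (rule deltoid_CD_two_lam)

end
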